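(* Let $W$ be an $\omega$-Stone space and $\mathscr{V}$ a complete Heyting* subalgebra of $\mathrm{Inv}(W)$. Let $\mathscr{V}_{\mathrm{cji}}$ denote the completely join irreducible elements of $\mathscr{V}$. Then $W$ is primitive iff $\mathscr{V}_{\mathrm{cji}}$ is a basis for $\mathscr{V}$.
   Context: A Stone space $W$ is a locally compact Hausdorff space with a base of compact open sets (the Stone space of a Boolean ring, possibly without $1$); it is an $\omega$-Stone space if $R=\mathrm{Co}(W)$, the Boolean ring of compact open subsets, is countable. For $A\in R$ let $(A)=\{C\in R: C\subseteq A\}$; $A$ is pseudo-indecomposable (PI) if for all $B\in R$ with $B\subseteq A$, $(B)\cong(A)$ or $(A-B)\cong(A)$. $W$ is primitive if every element of $R$ is the disjoint union of finitely many PI elements. The set $\mathscr{H}(W)$ of open subsets of $W$ is a complete Heyting* algebra with operations, for open sets $I_i,I,J$: $\sup\{I_i\}=\bigcup I_i$; $\inf\{I_i\}=[\bigcap I_i]^{o}$, where $A^o$ is the interior of $A$; $I\rightarrow J=[(W-I)\cup J]^{o}$; and $I^{*}=W-(W-I)'$, where $S'$ is the set of limit points of $S$. A complete Heyting* subalgebra is a subset containing $\emptyset$ and $W$ and closed under all these operations (including arbitrary sup and inf). $\mathrm{Inv}(W)$ is the set of open subsets of $W$ invariant under homeomorphisms $W\to W$; it is a complete Heyting* subalgebra of $\mathscr{H}(W)$. An element $J$ of a complete lattice is completely join irreducible (cji) if whenever $J\leqslant\sup E$ for a subset $E$ of the lattice, then $J\leqslant I$ for some $I\in E$. A subset of $\mathscr{V}$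 is a basis for $\mathscr{V}$ if every element of $\mathscr{V}$ is a union of elements of the subset. *)

theory Defs
  imports "HOL-Analysis.Analysis" "HOL-Algebra.QuotRing"
begin

section \<open>Stone spaces and their Boolean rings of compact open sets\<close>

definition Co :: "'a topology \<Rightarrow> 'a set set" where
  "Co W = {A. compactin W A \<and> openin W A}"

definition stone_space :: "'a topology \<Rightarrow> bool" where
  "stone_space W \<longleftrightarrow> locally_compact_space W \<and> Hausdorff_space W \<and>
     (\<forall>U. openin W U \<longrightarrow> (\<exists>B \<subseteq> Co W. U = \<Union>B))"

definition omega_stone_space :: "'a topology \<Rightarrow> bool" where
  "omega_stone_space W \<longleftrightarrow> stone_space W \<and> countable (Co W)"

text \<open>The ideal \<open>(A)\<close> of the ring of compact open sets; it is a Boolean ring with unit \<open>A\<close>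
  under symmetric difference and intersection.\<close>

definition principal_ideal :: "'a topology \<Rightarrow> 'a set \<Rightarrow> 'a set ring" where
  "principal_ideal W A =
     \<lparr>carrier = {C \<in> Co W. C \<subseteq> A}, mult = (\<inter>), one = A, zero = {}, add = sym_diff\<rparr>"

lemma cring_principal_ideal:
  assumes "Hausdorff_space W" "A \<in> Co W"
  shows "cring (principal_ideal W A)"
proof -
  have inter: "B \<inter> C \<in> Co W" if "B \<in> Co W" "C \<in> Co W" for B C
    using that assms(1) by (auto simp: Co_def intro: compactin_Int)
  have diff: "B - C \<in> Co W" if "B \<in> Co W" "C \<in> Co W" for B C
  proof -
    have cl: "closedin W C" "openin W C"
      using that assms(1) by (auto simp: Co_def compactin_imp_closedin)
    moreover have "B - C = B \<inter> (topspace W - C)"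
      using that by (auto simp: Co_def dest: openin_subset)
    ultimately have "compactin W (B - C)"
      using that by (auto simp: Co_def intro!: compact_Int_closedin)
    then show ?thesis
      using that cl by (auto simp: Co_def)
  qed
  have un: "B \<union> C \<in> Co W" if "B \<in> Co W" "C \<in> Co W" for B C
    using that by (auto simp: Co_def compactin_Un)
  have empty: "{} \<in> Co W"
    by (auto simp: Co_def)
  show ?thesis
  proof (rule cringI)
    show "abelian_group (principal_ideal W A)"
    proof (rule abelian_groupI)
      fix B assume "B \<in> carrier (principal_ideal W A)"
      then show "\<exists>C\<in>carrier (principal_ideal W A).
          C \<oplus>\<^bsub>principal_ideal W A\<^esub> B = \<zero>\<^bsub>principal_ideal W A\<^esub>"
        by (intro bexI[of _ B]) (auto simp: principal_ideal_def)
    qed (auto simp: principal_ideal_def empty un diff)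
    show "comm_monoid (principal_ideal W A)"
      using assms(2) by unfold_locales (auto simp: principal_ideal_def inter)
  qed (auto simp: principal_ideal_def)
qed

definition pseudo_indecomposable :: "'a topology \<Rightarrow> 'a set \<Rightarrow> bool" where
  "pseudo_indecomposable W A \<longleftrightarrow> A \<in> Co W \<and>
     (\<forall>B \<in> Co W. B \<subseteq> A \<longrightarrow>
        principal_ideal W B \<simeq> principal_ideal W A \<or>
        principal_ideal W (A - B) \<simeq> principal_ideal W A)"

definition primitive_space :: "'a topology \<Rightarrow> bool" where
  "primitive_space W \<longleftrightarrow>
     (\<forall>A \<in> Co W. \<exists>F. finite F \<and> disjoint F \<and> (\<forall>B \<in> F. pseudo_indecomposable W B) \<and> \<Union>F = A)"

section \<open>Complete Heyting* algebras of open sets\<close>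

text \<open>The intersection with \<open>topspace W\<close> makes the infimum of the empty family equal to
  the top element.\<close>

definition open_inf :: "'a topology \<Rightarrow> 'a set set \<Rightarrow> 'a set" where
  "open_inf W E = W interior_of (topspace W \<inter> \<Inter>E)"

definition open_imp :: "'a topology \<Rightarrow> 'a set \<Rightarrow> 'a set \<Rightarrow> 'a set" where
  "open_imp W I J = W interior_of ((topspace W - I) \<union> J)"

definition open_star :: "'a topology \<Rightarrow> 'a set \<Rightarrow> 'a set" where
  "open_star W I = topspace W - W derived_set_of (topspace W - I)"

definition complete_heyting_star_subalgebra :: "'a topology \<Rightarrow> 'a set set \<Rightarrow> bool" where
  "complete_heyting_star_subalgebra W V \<longleftrightarrow>
     V \<subseteq> {U. openin W U} \<and> {} \<in> V \<and> topspace W \<in> V \<and>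
     (\<forall>E \<subseteq> V. \<Union>E \<in> V) \<and> (\<forall>E \<subseteq> V. open_inf W E \<in> V) \<and>
     (\<forall>I \<in> V. \<forall>J \<in> V. open_imp W I J \<in> V) \<and> (\<forall>I \<in> V. open_star W I \<in> V)"

definition Inv :: "'a topology \<Rightarrow> 'a set set" where
  "Inv W = {U. openin W U \<and> (\<forall>f. homeomorphic_map W W f \<longrightarrow> f ` U = U)}"

text \<open>For families closed under unions, where suprema are unions. The family \<open>E\<close> may be empty,
  so the empty set is never completely join irreducible.\<close>

definition cji :: "'a set set \<Rightarrow> 'a set set" where
  "cji V = {J \<in> V. \<forall>E \<subseteq> V. J \<subseteq> \<Union>E \<longrightarrow> (\<exists>I \<in> E. J \<subseteq> I)}"

definition basis_for :: "'a set set \<Rightarrow> 'a set set \<Rightarrow> bool" where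
  "basis_for B V \<longleftrightarrow> B \<subseteq> V \<and> (\<forall>U \<in> V. \<exists>E \<subseteq> B. U = \<Union>E)"

end

theory Submission
  imports Defs
begin

text \<open>
  Both directions rest on reading a member of \<open>V\<close> off a compact open set: each compact open \<open>A\<close> lies
  in a least member \<open>J\<close> of \<open>V\<close>.

  Suppose \<open>W\<close> is primitive. Every member of \<open>V\<close> is a union of pseudo-indecomposable sets, so it
  suffices that \<open>J\<close> is completely join irreducible when \<open>A\<close> is pseudo-indecomposable and nonempty.
  By compactness this reduces to a finite cover of \<open>A\<close> by invariant open sets. If \<open>A\<close> is split along
  such a cover, one part \<open>B\<close> satisfies \<open>(B) \<cong> (A)\<close>, and then the invariant set containing \<open>B\<close>
  contains \<open>A\<close>: Stone duality turns the isomorphism into a bijection of \<open>A\<close> with \<open>B\<close>, which supplies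
  a homeomorphism of \<open>W\<close> exchanging \<open>A - B\<close> with a subset of \<open>B\<close>
  (\<open>invariant_contains_iso\<close>, \<open>PI_in_invariant_cover\<close>).

  Suppose conversely that the completely join irreducible members form a basis. Let \<open>core K\<close> be the
  set of points of such a member \<open>K\<close> that lie in no smaller member of \<open>V\<close>; these are the points of
  type \<open>K\<close>. They may leave out some points of \<open>W\<close>, but enough of them exist: by the implication
  operation, a neighbourhood of a point of type \<open>K\<close> has points of every type below \<open>K\<close>
  (\<open>trim_meets_lower_types\<close>). By the star operation, \<open>core K\<close> is either discrete or without isolated
  points. A compact open \<open>A \<subseteq> K\<close> is called trim of type \<open>K\<close> if it has a point of type \<open>K\<close>, and only one
  when \<open>core K\<close> is discrete. Three facts then finish the proof.

  \<^item> Every compact open set is a finite disjoint union of trim sets (\<open>Co_trim_sum\<close>). This is where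
    the basis property is used.

  \<^item> Trim sets of the same type have isomorphic ideals (\<open>trim_iso\<close>). A trim set of type \<open>K\<close> has room
    for trim sets of all types below \<open>K\<close> and remains trim without them, which is what Vaught's
    back-and-forth criterion for countable Boolean rings (\<open>sim_imp_iso\<close>) asks for.

  \<^item> If a trim set is divided in two, one of the parts is trim of the same type, so trim sets are
    pseudo-indecomposable (\<open>trim_PI\<close>).
\<close>

section \<open>Compact open sets\<close>

locale stone =
  fixes W :: "'a topology"
  assumes stone_space: "stone_space W"
begin

abbreviation below :: "'a set \<Rightarrow> 'a set set" where
  "below A \<equiv> {C \<in> Co W. C \<subseteq> A}"

lemma Hausdorff: "Hausdorff_space W"
  using stone_space by (simp add: stone_space_def)

lemma Co_open: "A \<in> Co W \<Longrightarrow> openin W A"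
  by (simp add: Co_def)

lemma Co_closed: "A \<in> Co W \<Longrightarrow> closedin W A"
  using Hausdorff by (auto simp: Co_def compactin_imp_closedin)

lemma Co_subset: "A \<in> Co W \<Longrightarrow> A \<subseteq> topspace W"
  by (simp add: Co_open openin_subset)

lemma Co_empty [simp]: "{} \<in> Co W"
  by (simp add: Co_def)

lemma Co_Int: "A \<in> Co W \<Longrightarrow> B \<in> Co W \<Longrightarrow> A \<inter> B \<in> Co W"
  using Hausdorff by (auto simp: Co_def intro: compactin_Int)

lemma Co_Un: "A \<in> Co W \<Longrightarrow> B \<in> Co W \<Longrightarrow> A \<union> B \<in> Co W"
  by (auto simp: Co_def compactin_Un)

lemma compactin_diff_open:
  assumes "A \<in> Co W" "openin W U"
  shows "compactin W (A - U)"
proof -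
  have "A - U = A \<inter> (topspace W - U)"
    using Co_subset[OF assms(1)] by auto
  then show ?thesis
    using assms by (auto simp: Co_def intro!: compact_Int_closedin)
qed

lemma Co_Diff: "A \<in> Co W \<Longrightarrow> B \<in> Co W \<Longrightarrow> A - B \<in> Co W"
  using compactin_diff_open[of A B] Co_open[of A] Co_open[of B] Co_closed[of B]
  by (simp add: Co_def openin_diff)

lemma Co_Union: "finite F \<Longrightarrow> F \<subseteq> Co W \<Longrightarrow> \<Union>F \<in> Co W"
  by (induction F rule: finite_induct) (auto intro: Co_Un)

lemma Co_between:
  assumes "compactin W S" "openin W U" "S \<subseteq> U"
  obtains B where "B \<in> Co W" "S \<subseteq> B" "B \<subseteq> U"
proof -
  obtain \<B> where \<B>: "\<B> \<subseteq> Co W" "U = \<Union>\<B>"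
    using stone_space assms(2) unfolding stone_space_def by blast
  then obtain F where "finite F" "F \<subseteq> \<B>" "S \<subseteq> \<Union>F"
    using compactinD[OF assms(1), of \<B>] assms(3) Co_open by blast
  then show thesis
    using \<B> by (intro that[of "\<Union>F"] Co_Union) auto
qed

lemma Co_nbhd:
  assumes "openin W U" "x \<in> U"
  obtains B where "B \<in> Co W" "x \<in> B" "B \<subseteq> U"
  using Co_between[of "{x}" U] assms openin_subset[OF assms(1)] by auto

lemma Co_separates:
  assumes "A \<in> Co W" "x \<in> A" "y \<in> A" "x \<noteq> y"
  obtains C where "C \<in> below A" "x \<in> C" "y \<notin> C"
proof -
  obtain U U' where U: "openin W U" "x \<in> U" "y \<in> U'" "disjnt U U'"
    using Hausdorff assms Co_subset unfolding Hausdorff_space_def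
    by (metis subsetD)
  obtain C where "C \<in> Co W" "x \<in> C" "C \<subseteq> U \<inter> A"
    using Co_nbhd[of "U \<inter> A" x] U(1,2) assms Co_open by blast
  then show thesis
    using that U by (auto simp: disjnt_iff)
qed

text \<open>The part of \<open>A\<close> that only one member \<open>U\<close> of the cover reaches is compact, so some compact open
  subset of \<open>U\<close> contains it, and the other members cover the rest of \<open>A\<close>.\<close>

lemma partition_subordinate:
  assumes "finite \<U>" "A \<in> Co W" "A \<subseteq> \<Union>\<U>" "\<And>U. U \<in> \<U> \<Longrightarrow> openin W U"
  shows "\<exists>g. (\<forall>U\<in>\<U>. g U \<in> Co W \<and> g U \<subseteq> U) \<and> disjoint_family_on g \<U> \<and> (\<Union>U\<in>\<U>. g U) = A"
  using assms
proof (induction \<U> arbitrary: A rule: finite_induct)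
  case empty
  then show ?case by (auto simp: disjoint_family_on_def)
next
  case (insert U \<U>)
  have op: "openin W (\<Union>\<U>)" "openin W U"
    using insert by auto
  obtain B where B: "B \<in> Co W" "A - \<Union>\<U> \<subseteq> B" "B \<subseteq> U \<inter> A"
  proof (rule Co_between)
    show "compactin W (A - \<Union>\<U>)" "openin W (U \<inter> A)" "A - \<Union>\<U> \<subseteq> U \<inter> A"
      using insert.prems(1,2) op by (auto intro: Co_open compactin_diff_open)
  qed
  have "A - B \<in> Co W" "A - B \<subseteq> \<Union>\<U>"
    using B insert.prems Co_Diff by auto
  then obtain g where g: "\<forall>U\<in>\<U>. g U \<in> Co W \<and> g U \<subseteq> U" "disjoint_family_on g \<U>"
      "(\<Union>U\<in>\<U>. g U) = A - B"
    using insert.IH[of "A - B"] insert.prems(3) by auto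
  have "disjoint_family_on (g(U := B)) (insert U \<U>)"
    using g(2,3) insert.hyps(2) by (auto simp: disjoint_family_on_def)
  moreover have "(\<Union>V\<in>insert U \<U>. (g(U := B)) V) = A"
    using g(3) B insert.hyps(2) by (auto split: if_splits)
  moreover have "\<forall>V\<in>insert U \<U>. (g(U := B)) V \<in> Co W \<and> (g(U := B)) V \<subseteq> V"
    using g(1) B by auto
  ultimately show ?case
    by (rule_tac x = "g(U := B)" in exI) (simp only: simp_thms)
qed

lemma least_member:
  assumes alg: "complete_heyting_star_subalgebra W V" and A: "A \<in> Co W"
  obtains J where "J \<in> V" "A \<subseteq> J" "\<forall>I\<in>V. A \<subseteq> I \<longrightarrow> J \<subseteq> I"
proof
  let ?J = "open_inf W {I \<in> V. A \<subseteq> I}"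
  show "?J \<in> V"
    using alg by (simp add: complete_heyting_star_subalgebra_def)
  show "A \<subseteq> ?J"
    unfolding open_inf_def
    using Co_open[OF A] Co_subset[OF A] by (intro interior_of_maximal) auto
  have "?J \<subseteq> topspace W \<inter> \<Inter>{I \<in> V. A \<subseteq> I}"
    unfolding open_inf_def by (rule interior_of_subset)
  then show "\<forall>I\<in>V. A \<subseteq> I \<longrightarrow> ?J \<subseteq> I" by blast
qed

section \<open>Stone duality for principal ideals\<close>

text \<open>The point corresponding to \<open>x\<close> is the intersection of the images of the compact open
  neighbourhoods of \<open>x\<close>. Any finitely many of these images include the image of a smaller
  neighbourhood, so compactness of \<open>B\<close> gives a common point. It avoids \<open>\<phi> C\<close> when \<open>x \<notin> C\<close>, because it
  lies in \<open>\<phi> (A - C)\<close> and order isomorphisms preserve disjointness.\<close>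

lemma stone_point_map:
  assumes A: "A \<in> Co W" and B: "B \<in> Co W"
    and bij: "bij_betw \<phi> (below A) (below B)"
    and ord: "\<And>C D. C \<in> below A \<Longrightarrow> D \<in> below A \<Longrightarrow> \<phi> C \<subseteq> \<phi> D \<longleftrightarrow> C \<subseteq> D"
  shows "\<exists>h. \<forall>x\<in>A. h x \<in> B \<and> (\<forall>C\<in>below A. h x \<in> \<phi> C \<longleftrightarrow> x \<in> C)"
proof -
  have into: "\<phi> C \<in> below B" if "C \<in> below A" for C
    using that bij_betwE[OF bij] by blast
  have onto: "\<exists>C\<in>below A. \<phi> C = D" if "D \<in> below B" for D
    using that bij_betw_imp_surj_on[OF bij] by (metis (lifting) imageE)
  have disj: "\<phi> C \<inter> \<phi> D = {}" if CD: "C \<in> below A" "D \<in> below A" "C \<inter> D = {}" for C D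
  proof -
    have "\<phi> C \<inter> \<phi> D \<in> below B"
      using into[OF CD(1)] into[OF CD(2)] Co_Int by auto
    then obtain E where E: "E \<in> below A" "\<phi> E = \<phi> C \<inter> \<phi> D"
      using onto by blast
    then have "E \<subseteq> C" "E \<subseteq> D"
      using ord[OF E(1)] CD by auto
    then have "E = {}"
      using CD by auto
    moreover obtain Z where Z: "Z \<in> below A" "\<phi> Z = {}"
      using onto[of "{}"] by auto
    moreover have "\<phi> {} \<subseteq> \<phi> Z"
      using ord[of "{}" Z] Z(1) by simp
    ultimately show ?thesis
      using E(2) by simp
  qed
  have "\<exists>y\<in>B. \<forall>C\<in>below A. x \<in> C \<longrightarrow> y \<in> \<phi> C" if x: "x \<in> A" for x
  proof (rule ccontr)
    assume "\<not> ?thesis"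
    then have cov: "\<forall>y\<in>B. \<exists>C\<in>below A. x \<in> C \<and> y \<notin> \<phi> C" by blast
    let ?\<U> = "(\<lambda>C. B - \<phi> C) ` {C \<in> below A. x \<in> C}"
    have "B \<subseteq> \<Union>?\<U>"
      using cov by blast
    moreover have "openin W U" if "U \<in> ?\<U>" for U
      using that into B Co_Diff Co_open by blast
    moreover have "compactin W B"
      using B by (simp add: Co_def)
    ultimately have "\<exists>\<F>. finite \<F> \<and> \<F> \<subseteq> ?\<U> \<and> B \<subseteq> \<Union>\<F>"
      by (intro compactinD)
    then obtain \<F> where \<F>: "finite \<F>" "\<F> \<subseteq> ?\<U>" "B \<subseteq> \<Union>\<F>"
      by (elim exE conjE)
    from finite_subset_image[OF \<F>(1,2)] obtain F
      where F0: "F \<subseteq> {C \<in> below A. x \<in> C}" "finite F" "\<F> = (\<lambda>C. B - \<phi> C) ` F"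
      by (elim exE conjE)
    have F: "finite F" "F \<subseteq> {C \<in> below A. x \<in> C}" "B \<subseteq> \<Union>((\<lambda>C. B - \<phi> C) ` F)"
      using F0 \<F>(3) by simp_all
    have "\<exists>D\<in>below A. x \<in> D \<and> (\<forall>C\<in>F. D \<subseteq> C)"
      using F(1,2)
    proof (induction F rule: finite_induct)
      case empty
      then show ?case using A x by auto
    next
      case (insert C F)
      then obtain D where "D \<in> below A" "x \<in> D" "\<forall>C\<in>F. D \<subseteq> C" by auto
      then show ?case
        using insert.prems Co_Int by (intro bexI[of _ "D \<inter> C"]) auto
    qed
    then obtain D where D: "D \<in> below A" "x \<in> D" "\<forall>C\<in>F. D \<subseteq> C" by blast
    have "\<phi> D \<subseteq> \<phi> C" if "C \<in> F" for C
      using that D ord[of D C] F(2) by blast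
    then have "\<phi> D \<subseteq> \<phi> {}"
      using F(3) into[OF D(1)] by blast
    then show False
      using ord[of D "{}"] D by auto
  qed
  then obtain h where h: "\<And>x. x \<in> A \<Longrightarrow> h x \<in> B"
      "\<And>x C. x \<in> A \<Longrightarrow> C \<in> below A \<Longrightarrow> x \<in> C \<Longrightarrow> h x \<in> \<phi> C"
    by metis
  have mem: "x \<in> C" if x: "x \<in> A" "C \<in> below A" "h x \<in> \<phi> C" for x C
  proof (rule ccontr)
    assume "x \<notin> C"
    moreover have "A - C \<in> below A"
      using x A Co_Diff by auto
    ultimately have "h x \<in> \<phi> (A - C)"
      using h(2) x(1) by blast
    then show False
      using disj[of C "A - C"] x \<open>A - C \<in> below A\<close> by auto
  qed
  show ?thesis
    by (intro exI[of _ h] ballI conjI iffI; (rule h mem; assumption))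
qed

lemma stone_duality:
  assumes A: "A \<in> Co W" and B: "B \<in> Co W"
    and iso: "principal_ideal W A \<simeq> principal_ideal W B"
  obtains h where "bij_betw h A B"
    "\<And>C. C \<in> below A \<Longrightarrow> h ` C \<in> Co W"
    "\<And>D. D \<in> below B \<Longrightarrow> {x \<in> A. h x \<in> D} \<in> Co W"
proof -
  obtain \<phi> where \<phi>: "\<phi> \<in> ring_hom (principal_ideal W A) (principal_ideal W B)"
      and bij: "bij_betw \<phi> (below A) (below B)"
    using iso unfolding is_ring_iso_def ring_iso_def principal_ideal_def by auto
  have mult: "\<phi> (C \<inter> D) = \<phi> C \<inter> \<phi> D" if "C \<in> below A" "D \<in> below A" for C D
    using that ring_hom_mult[OF \<phi>, of C D] by (simp add: principal_ideal_def)
  have inj: "\<phi> C = \<phi> D \<longleftrightarrow> C = D" if "C \<in> below A" "D \<in> below A" for C D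
    using that bij unfolding bij_betw_def inj_on_def by blast
  have ord: "\<phi> C \<subseteq> \<phi> D \<longleftrightarrow> C \<subseteq> D" if CD: "C \<in> below A" "D \<in> below A" for C D
  proof -
    have "C \<inter> D \<in> below A"
      using CD Co_Int by auto
    then show ?thesis
      using inj[of "C \<inter> D" C] mult[OF CD] CD by (metis le_iff_inf)
  qed
  let ?\<psi> = "the_inv_into (below A) \<phi>"
  have bij': "bij_betw ?\<psi> (below B) (below A)"
    using bij by (rule bij_betw_the_inv_into)
  have \<phi>\<psi>: "\<phi> (?\<psi> D) = D" "?\<psi> D \<in> below A" if "D \<in> below B" for D
    using f_the_inv_into_f_bij_betw[OF bij, of D] that bspec[OF bij_betwE[OF bij'] that]
    by (simp_all only: simp_thms)
  have \<psi>\<phi>: "?\<psi> (\<phi> C) = C" "\<phi> C \<in> below B" if "C \<in> below A" for C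
    using the_inv_into_f_f[OF bij_betw_imp_inj_on[OF bij] that] bspec[OF bij_betwE[OF bij] that]
    by (simp_all only:)
  have ord': "?\<psi> C \<subseteq> ?\<psi> D \<longleftrightarrow> C \<subseteq> D" if "C \<in> below B" "D \<in> below B" for C D
    using ord[OF \<phi>\<psi>(2)[OF that(1)] \<phi>\<psi>(2)[OF that(2)]] \<phi>\<psi>(1)[OF that(1)] \<phi>\<psi>(1)[OF that(2)]
    by (simp only:)
  have "\<exists>h. \<forall>x\<in>A. h x \<in> B \<and> (\<forall>C\<in>below A. h x \<in> \<phi> C \<longleftrightarrow> x \<in> C)"
    by (rule stone_point_map[OF A B bij]) (rule ord)
  then obtain h where h': "\<forall>x\<in>A. h x \<in> B \<and> (\<forall>C\<in>below A. h x \<in> \<phi> C \<longleftrightarrow> x \<in> C)"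
    by (elim exE)
  have h: "h x \<in> B" "C \<in> below A \<Longrightarrow> h x \<in> \<phi> C \<longleftrightarrow> x \<in> C" if "x \<in> A" for x C
    by (rule conjunct1[OF bspec[OF h' that]], rule bspec[OF conjunct2[OF bspec[OF h' that]]])
  have "\<exists>k. \<forall>y\<in>B. k y \<in> A \<and> (\<forall>D\<in>below B. k y \<in> ?\<psi> D \<longleftrightarrow> y \<in> D)"
    by (rule stone_point_map[OF B A bij']) (rule ord')
  then obtain k where k': "\<forall>y\<in>B. k y \<in> A \<and> (\<forall>D\<in>below B. k y \<in> ?\<psi> D \<longleftrightarrow> y \<in> D)"
    by (elim exE)
  have k: "k y \<in> A" "D \<in> below B \<Longrightarrow> k y \<in> ?\<psi> D \<longleftrightarrow> y \<in> D" if "y \<in> B" for y D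
    by (rule conjunct1[OF bspec[OF k' that]], rule bspec[OF conjunct2[OF bspec[OF k' that]]])
  have kh: "k (h x) = x" if x: "x \<in> A" for x
  proof (rule ccontr)
    assume "k (h x) \<noteq> x"
    then obtain C where C: "C \<in> below A" "k (h x) \<in> C" "x \<notin> C"
      using Co_separates[OF A, of "k (h x)" x] h k x by metis
    then show False
      using k(2)[OF h(1)[OF x] \<psi>\<phi>(2)[OF C(1)]] h(2)[OF x C(1)] \<psi>\<phi>(1)[OF C(1)] by simp
  qed
  have hk: "h (k y) = y" if y: "y \<in> B" for y
  proof (rule ccontr)
    assume "h (k y) \<noteq> y"
    then obtain D where D: "D \<in> below B" "h (k y) \<in> D" "y \<notin> D"
      using Co_separates[OF B, of "h (k y)" y] h k y by metis
    then show False
      using h(2)[OF k(1)[OF y] \<phi>\<psi>(2)[OF D(1)]] k(2)[OF y D(1)] \<phi>\<psi>(1)[OF D(1)] by simp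
  qed
  show thesis
  proof
    show "bij_betw h A B"
      by (rule bij_betw_byWitness[of _ k]) (use h(1) k(1) kh hk in auto)
    show "h ` C \<in> Co W" if C: "C \<in> below A" for C
    proof -
      have "h ` C \<subseteq> \<phi> C"
        using h(2) C by blast
      moreover have "y \<in> h ` C" if y: "y \<in> \<phi> C" for y
      proof -
        have "y \<in> B" using y \<psi>\<phi>(2)[OF C] by auto
        then have "k y \<in> C" using k(2)[OF _ \<psi>\<phi>(2)[OF C]] \<psi>\<phi>(1)[OF C] y by simp
        then show ?thesis using hk[OF \<open>y \<in> B\<close>] by (metis imageI)
      qed
      ultimately have "h ` C = \<phi> C" by blast
      then show ?thesis using \<psi>\<phi>(2)[OF C] by simp
    qed
    show "{x \<in> A. h x \<in> D} \<in> Co W" if D: "D \<in> below B" for D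
    proof -
      have "{x \<in> A. h x \<in> D} = ?\<psi> D"
        using h(2) \<phi>\<psi>[OF D] by auto
      then show ?thesis using \<phi>\<psi>(2)[OF D] by simp
    qed
  qed
qed

section \<open>Invariant sets and pseudo-indecomposable sets\<close>

lemma continuous_map_Co:
  assumes "\<And>x. x \<in> topspace W \<Longrightarrow> f x \<in> topspace W"
    and "\<And>C. C \<in> Co W \<Longrightarrow> openin W {x \<in> topspace W. f x \<in> C}"
  shows "continuous_map W W f"
  unfolding continuous_map_def
proof (intro conjI allI impI)
  show "f \<in> topspace W \<rightarrow> topspace W" using assms(1) by blast
  fix U assume "openin W U"
  then obtain \<B> where \<B>: "\<B> \<subseteq> Co W" "U = \<Union>\<B>"
    using stone_space unfolding stone_space_def by blast
  have "{x \<in> topspace W. f x \<in> U} = \<Union>((\<lambda>C. {x \<in> topspace W. f x \<in> C}) ` \<B>)"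
    using \<B> by auto
  also have "openin W \<dots>"
    using \<B> assms(2) by (intro openin_Union) blast
  finally show "openin W {x \<in> topspace W. f x \<in> U}" .
qed

text \<open>An isomorphism of \<open>(A)\<close> with \<open>(B)\<close> need not extend to \<open>W\<close> when \<open>B \<subseteq> A\<close>. But by duality it
  comes from a bijection \<open>h\<close> of \<open>A\<close> with \<open>B\<close>, and \<open>h\<close> maps \<open>N = A - B\<close> into \<open>B\<close>, off itself;
  so exchanging \<open>N\<close> and \<open>h ` N\<close> and fixing all other points is a homeomorphism of \<open>W\<close>. It
  carries each point of \<open>A - B\<close> into \<open>B\<close>.\<close>

lemma invariant_contains_iso:
  assumes A: "A \<in> Co W" and B: "B \<in> Co W" and BA: "B \<subseteq> A"
    and iso: "principal_ideal W B \<simeq> principal_ideal W A"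
    and I: "I \<in> Inv W" and BI: "B \<subseteq> I"
  shows "A \<subseteq> I"
proof -
  have "principal_ideal W A \<simeq> principal_ideal W B"
    using ring_iso_sym[OF cring.axioms(1)[OF cring_principal_ideal[OF Hausdorff B]] iso] .
  then obtain h where h: "bij_betw h A B"
    "\<And>C. C \<in> below A \<Longrightarrow> h ` C \<in> Co W"
    "\<And>D. D \<in> below B \<Longrightarrow> {x \<in> A. h x \<in> D} \<in> Co W"
    using stone_duality[OF A B] by blast
  define N where "N = A - B"
  define k where "k = the_inv_into A h"
  define f where "f x = (if x \<in> N then h x else if x \<in> h ` N then k x else x)" for x
  have N: "N \<in> below A"
    using A B Co_Diff by (auto simp: N_def)
  have kh: "k (h x) = x" if "x \<in> A" for x
    using that h(1) by (simp add: k_def bij_betw_def the_inv_into_f_f)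
  have hN: "h ` N \<subseteq> B" "h ` N \<in> Co W" "h ` N \<inter> N = {}"
    using h(1,2) N by (auto simp: bij_betw_def N_def)
  have NA: "x \<in> A" if "x \<in> N" for x using that N by auto
  have ff: "f (f x) = x" for x
    using hN(3) kh NA by (auto simp: f_def)
  have fh: "f (h x) = x" if "x \<in> N" for x
    using that hN(3) kh NA by (auto simp: f_def)
  have fW: "f x \<in> topspace W" if "x \<in> topspace W" for x
    using that hN(1) Co_subset[OF B] Co_subset[OF A] kh NA by (auto simp: f_def)
  have fCo: "{x \<in> topspace W. f x \<in> C} \<in> Co W" if C: "C \<in> Co W" for C
  proof -
    have "{x \<in> topspace W. f x \<in> C} =
        ({x \<in> A. h x \<in> C \<inter> B} \<inter> N) \<union> h ` (C \<inter> N) \<union> (C - N - h ` N)" (is "?L = ?R")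
    proof
      show "?L \<subseteq> ?R"
        using hN NA kh by (auto simp: f_def split: if_splits)
      have "?R \<subseteq> topspace W"
        using Co_subset[OF A] Co_subset[OF C] Co_subset[OF hN(2)] by auto
      moreover have "f x \<in> C" if "x \<in> ?R" for x
        using that
      proof (elim UnE)
        assume "x \<in> h ` (C \<inter> N)"
        then show ?thesis using fh by auto
      qed (auto simp: f_def)
      ultimately show "?R \<subseteq> ?L" by blast
    qed
    moreover have "{x \<in> A. h x \<in> C \<inter> B} \<in> Co W" "h ` (C \<inter> N) \<in> Co W"
      using h(2)[of "C \<inter> N"] h(3)[of "C \<inter> B"] C B N Co_Int by auto
    ultimately show ?thesis
      using N C hN(2) by (simp add: Co_Un Co_Int Co_Diff)
  qed
  have "continuous_map W W f"
    using continuous_map_Co fW fCo Co_open by blast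
  then have "homeomorphic_maps W W f f"
    using ff by (simp add: homeomorphic_maps_def)
  then have fI: "f ` I = I"
    using I homeomorphic_map_maps unfolding Inv_def by blast
  have "x \<in> I" if "x \<in> N" for x
  proof -
    have "f x \<in> I" using that hN(1) BI by (auto simp: f_def)
    then show ?thesis using fI ff by (metis imageI)
  qed
  then show ?thesis using BI by (auto simp: N_def)
qed

lemma Inv_Union: "E \<subseteq> Inv W \<Longrightarrow> \<Union>E \<in> Inv W"
  unfolding Inv_def by (simp add: image_Union subset_iff) blast

text \<open>For a cover by two sets, split \<open>A\<close> along it: one of the two parts is isomorphic to \<open>A\<close>, and
  then the invariant set containing that part contains \<open>A\<close>.\<close>

lemma PI_in_invariant_cover:
  assumes "finite E" "pseudo_indecomposable W A" "A \<noteq> {}" "A \<subseteq> \<Union>E" "E \<subseteq> Inv W"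
  shows "\<exists>I\<in>E. A \<subseteq> I"
  using assms
proof (induction E rule: finite_induct)
  case empty
  then show ?case by simp
next
  case (insert I E)
  have A: "A \<in> Co W"
    using insert.prems(1) by (simp add: pseudo_indecomposable_def)
  have inv: "I \<in> Inv W" "\<Union>E \<in> Inv W"
    using insert.prems(4) Inv_Union by auto
  then have op: "openin W I" "openin W (\<Union>E)"
    by (auto simp: Inv_def)
  obtain B where B: "B \<in> Co W" "A - \<Union>E \<subseteq> B" "B \<subseteq> I \<inter> A"
  proof (rule Co_between)
    show "compactin W (A - \<Union>E)" "openin W (I \<inter> A)" "A - \<Union>E \<subseteq> I \<inter> A"
      using insert.prems(3) A op by (auto intro: Co_open compactin_diff_open)
  qed
  then consider "principal_ideal W B \<simeq> principal_ideal W A"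
    | "principal_ideal W (A - B) \<simeq> principal_ideal W A"
    using insert.prems(1) unfolding pseudo_indecomposable_def by blast
  then show ?case
  proof cases
    case 1
    then have "A \<subseteq> I"
      using invariant_contains_iso[OF A B(1) _ 1 inv(1)] B(3) by blast
    then show ?thesis by blast
  next
    case 2
    then have "A \<subseteq> \<Union>E"
      using invariant_contains_iso[OF A Co_Diff[OF A B(1)] _ 2 inv(2)] B(2) by blast
    then show ?thesis
      using insert.IH insert.prems by auto
  qed
qed

text \<open>The least element of the subalgebra containing a nonempty pseudo-indecomposable set is
  completely join irreducible, since a cover of it has a finite subfamily covering that set.\<close>

lemma primitive_imp_basis:
  assumes prim: "primitive_space W" and alg: "complete_heyting_star_subalgebra W V"
    and inv: "V \<subseteq> Inv W"
  shows "basis_for (cji V) V"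
  unfolding basis_for_def
proof (intro conjI ballI)
  show "cji V \<subseteq> V" by (auto simp: cji_def)
  fix U assume U: "U \<in> V"
  have "\<exists>J\<in>cji V. x \<in> J \<and> J \<subseteq> U" if x: "x \<in> U" for x
  proof -
    have op: "openin W U" using U inv by (auto simp: Inv_def)
    obtain A0 where A0: "A0 \<in> Co W" "x \<in> A0" "A0 \<subseteq> U"
      using Co_nbhd[OF op x] .
    from bspec[OF prim[unfolded primitive_space_def] A0(1)]
    obtain F where "\<forall>B\<in>F. pseudo_indecomposable W B" "\<Union>F = A0"
      by (elim exE conjE)
    with A0 obtain A where A: "pseudo_indecomposable W A" "x \<in> A" "A \<subseteq> U"
      by auto
    then have ACo: "A \<in> Co W" by (simp add: pseudo_indecomposable_def)
    obtain J where J: "J \<in> V" and AJ: "A \<subseteq> J"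
      and J_min: "\<forall>I\<in>V. A \<subseteq> I \<longrightarrow> J \<subseteq> I"
      using least_member[OF alg ACo] .
    have least: "J \<subseteq> I" if "I \<in> V" "A \<subseteq> I" for I
      using J_min that by simp
    have "\<exists>I\<in>E. J \<subseteq> I" if E: "E \<subseteq> V" "J \<subseteq> \<Union>E" for E
    proof -
      have "\<And>I. I \<in> E \<Longrightarrow> openin W I"
        using E inv by (auto simp: Inv_def)
      moreover have "compactin W A" "A \<subseteq> \<Union>E"
        using ACo AJ E by (auto simp: Co_def)
      ultimately have "\<exists>E'. finite E' \<and> E' \<subseteq> E \<and> A \<subseteq> \<Union>E'"
        by (intro compactinD)
      then obtain E' where E': "finite E'" "E' \<subseteq> E" "A \<subseteq> \<Union>E'"
        by (elim exE conjE)
      then have "\<exists>I\<in>E'. A \<subseteq> I"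
        using A inv E by (intro PI_in_invariant_cover) auto
      then show ?thesis using least E E'(2) by blast
    qed
    then have "J \<in> cji V" using J by (simp add: cji_def)
    then show ?thesis using AJ A least[OF U] by blast
  qed
  then show "\<exists>E\<subseteq>cji V. U = \<Union>E"
    by (intro exI[of _ "{J \<in> cji V. J \<subseteq> U}"]) blast
qed

end

section \<open>Vaught's back-and-forth criterion\<close>

text \<open>For \<open>s \<subseteq> F\<close> these are the atoms, possibly empty, of the algebra of subsets of \<open>A\<close> generated by the
  sets \<open>A \<inter> c p\<close>.\<close>

definition cell :: "'a set \<Rightarrow> ('i \<Rightarrow> 'a set) \<Rightarrow> 'i set \<Rightarrow> 'i set \<Rightarrow> 'a set" where
  "cell A c F s = {x \<in> A. \<forall>p\<in>F. x \<in> c p \<longleftrightarrow> p \<in> s}"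

lemma cell_empty [simp]: "cell A c {} s = A"
  by (simp add: cell_def)

lemma cell_insert:
  assumes "p \<notin> F"
  shows "cell A c (insert p F) s =
    (if p \<in> s then cell A c F (s - {p}) \<inter> c p else cell A c F (s - {p}) - c p)"
  using assms by (auto simp: cell_def)

lemma cell_disjoint:
  assumes "x \<in> cell A c F s" "x \<in> cell A c F t" "s \<subseteq> F" "t \<subseteq> F"
  shows "s = t"
  using assms by (auto simp: cell_def)

locale vaught_relation = stone +
  fixes sim :: "'a set \<Rightarrow> 'a set \<Rightarrow> bool"
  assumes countable_Co: "countable (Co W)"
    and sim_Co: "sim A B \<Longrightarrow> A \<in> Co W"
    and sim_sym: "sim A B \<Longrightarrow> sim B A"
    and sim_empty: "sim A B \<Longrightarrow> A = {} \<longleftrightarrow> B = {}"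
    and sim_split: "sim A B \<Longrightarrow> C \<in> Co W \<Longrightarrow> C \<subseteq> A \<Longrightarrow> \<exists>D\<subseteq>B. sim C D \<and> sim (A - C) (B - D)"
begin

text \<open>A finite set \<open>F\<close> of pairs \<open>(C, D)\<close> is a finite piece of a correspondence between subsets of \<open>A\<close>
  and of \<open>B\<close>. It can be continued if corresponding atoms are related.\<close>

definition matches :: "'a set \<Rightarrow> 'a set \<Rightarrow> ('a set \<times> 'a set) set \<Rightarrow> bool" where
  "matches A B F \<longleftrightarrow> (\<forall>s\<subseteq>F. sim (cell A fst F s) (cell B snd F s))"

lemma matches_converse:
  assumes "matches A B F"
  shows "matches B A (F\<inverse>)"
  unfolding matches_def
proof (intro allI impI)
  fix s :: "('a set \<times> 'a set) set"
  assume "s \<subseteq> F\<inverse>"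
  then have "s\<inverse> \<subseteq> F" by auto
  then have "sim (cell B snd F (s\<inverse>)) (cell A fst F (s\<inverse>))"
    using assms sim_sym by (simp add: matches_def)
  moreover have "cell B fst (F\<inverse>) s = cell B snd F (s\<inverse>)" "cell A snd (F\<inverse>) s = cell A fst F (s\<inverse>)"
    by (force simp: cell_def)+
  ultimately show "sim (cell B fst (F\<inverse>) s) (cell A snd (F\<inverse>) s)" by simp
qed

text \<open>The splitting property is applied inside each cell, and the partners found there are
  glued.\<close>

lemma matches_extend:
  assumes fin: "finite F" and F: "matches A B F" and C: "C \<in> Co W"
  shows "\<exists>D\<in>below B. matches A B (insert (C, D) F)"
proof -
  have "\<exists>D. D \<subseteq> cell B snd F s \<and> sim (cell A fst F s \<inter> C) D \<and>
      sim (cell A fst F s - C) (cell B snd F s - D)" if "s \<in> Pow F" for s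
  proof -
    have s: "sim (cell A fst F s) (cell B snd F s)"
      using that F by (simp add: matches_def)
    have "cell A fst F s \<inter> C \<in> Co W"
      using sim_Co[OF s] C by (rule Co_Int)
    from sim_split[OF s this Int_lower1] show ?thesis
      by (simp add: Diff_Int)
  qed
  then have "\<forall>s\<in>Pow F. \<exists>D. D \<subseteq> cell B snd F s \<and> sim (cell A fst F s \<inter> C) D \<and>
      sim (cell A fst F s - C) (cell B snd F s - D)" by (rule ballI)
  from bchoice[OF this] obtain g where g: "\<forall>s\<in>Pow F. g s \<subseteq> cell B snd F s \<and>
      sim (cell A fst F s \<inter> C) (g s) \<and> sim (cell A fst F s - C) (cell B snd F s - g s)"
    by (elim exE)
  define D where "D = \<Union>(g ` Pow F)"
  have sub: "g s \<subseteq> cell B snd F s" if "s \<subseteq> F" for s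
    using g that by simp
  have D_cell: "cell B snd F s \<inter> D = g s" if s: "s \<subseteq> F" for s
  proof
    show "g s \<subseteq> cell B snd F s \<inter> D"
      using sub[OF s] s by (auto simp: D_def)
    show "cell B snd F s \<inter> D \<subseteq> g s"
    proof
      fix x assume x: "x \<in> cell B snd F s \<inter> D"
      then obtain t where t: "t \<subseteq> F" "x \<in> g t" by (auto simp: D_def)
      then have "s = t"
        using cell_disjoint[of x B snd F s t] x sub[OF t(1)] s by blast
      then show "x \<in> g s" using t(2) by simp
    qed
  qed
  have "D \<in> Co W"
    unfolding D_def
  proof (rule Co_Union)
    show "finite (g ` Pow F)" using fin by simp
    show "g ` Pow F \<subseteq> Co W"
    proof (rule image_subsetI)
      fix s assume "s \<in> Pow F"
      then have "sim (cell A fst F s \<inter> C) (g s)" using g by simp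
      then show "g s \<in> Co W" by (rule sim_Co[OF sim_sym])
    qed
  qed
  moreover have "D \<subseteq> B"
  proof -
    have "g s \<subseteq> B" if "s \<subseteq> F" for s
      using sub[OF that] by (auto simp: cell_def)
    then show ?thesis unfolding D_def by (intro UN_least) simp
  qed
  moreover have "matches A B (insert (C, D) F)"
  proof (cases "(C, D) \<in> F")
    case True
    then show ?thesis using F by (simp add: insert_absorb)
  next
    case False
    show ?thesis
      unfolding matches_def
    proof (intro allI impI)
      fix s assume "s \<subseteq> insert (C, D) F"
      then have t: "s - {(C, D)} \<subseteq> F" by auto
      have eq: "cell B snd F (s - {(C, D)}) - D = cell B snd F (s - {(C, D)}) - g (s - {(C, D)})"
        using D_cell[OF t] by blast
      have "sim (cell A fst F (s - {(C, D)}) \<inter> C) (g (s - {(C, D)}))"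
        "sim (cell A fst F (s - {(C, D)}) - C) (cell B snd F (s - {(C, D)}) - g (s - {(C, D)}))"
        using bspec[OF g, of "s - {(C, D)}"] t by simp_all
      then show "sim (cell A fst (insert (C, D) F) s) (cell B snd (insert (C, D) F) s)"
        by (cases "(C, D) \<in> s")
          (simp_all only: cell_insert[OF False] fst_conv snd_conv D_cell[OF t] eq if_True if_False simp_thms)
    qed
  qed
  ultimately show ?thesis by (intro bexI[of _ D]) simp_all
qed

lemma matches_extend_converse:
  assumes fin: "finite F" and F: "matches A B F" and D: "D \<in> Co W"
  shows "\<exists>C\<in>below A. matches A B (insert (C, D) F)"
proof -
  have "finite (F\<inverse>)" using fin by simp
  from matches_extend[OF this matches_converse[OF F] D]
  obtain C where C: "C \<in> below A" "matches B A (insert (D, C) (F\<inverse>))"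
    by (elim bexE)
  have "(insert (D, C) (F\<inverse>))\<inverse> = insert (C, D) F" by auto
  then have "matches A B (insert (C, D) F)"
    using matches_converse[OF C(2)] by simp
  then show ?thesis using C(1) by (rule bexI)
qed

lemma matches_realize:
  assumes F: "matches A B F" and y: "y \<in> B"
  shows "\<exists>x\<in>A. \<forall>p\<in>F. x \<in> fst p \<longleftrightarrow> y \<in> snd p"
proof -
  define s where "s = {p \<in> F. y \<in> snd p}"
  have "y \<in> cell B snd F s"
    using y by (simp add: s_def cell_def)
  moreover have "sim (cell A fst F s) (cell B snd F s)"
    using F by (simp add: matches_def s_def)
  ultimately obtain x where "x \<in> cell A fst F s"
    using sim_empty by blast
  then show ?thesis
    by (intro bexI[of _ x]) (auto simp: cell_def s_def)
qed

lemma matches_realize_converse: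
  assumes "matches A B F" "x \<in> A"
  shows "\<exists>y\<in>B. \<forall>p\<in>F. x \<in> fst p \<longleftrightarrow> y \<in> snd p"
proof -
  from matches_realize[OF matches_converse[OF assms(1)] assms(2)]
  obtain y where y: "y \<in> B" "\<forall>p\<in>F\<inverse>. y \<in> fst p \<longleftrightarrow> x \<in> snd p"
    by (elim bexE)
  have "x \<in> fst p \<longleftrightarrow> y \<in> snd p" if "p \<in> F" for p
    using bspec[OF y(2), of "(snd p, fst p)"] that by simp
  then show ?thesis using y(1) by blast
qed

text \<open>Since both rings are countable, alternating the two extension steps exhausts them. In the
  limit \<open>G\<close> every Boolean identity between finitely many first components is an identity between
  the second components and conversely, because a violating point on one side is realized by a
  point on the other. So \<open>G\<close> is the graph of an isomorphism.\<close>

theorem sim_imp_iso: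
  assumes AB: "sim A B"
  shows "principal_ideal W A \<simeq> principal_ideal W B"
proof -
  define c where "c = from_nat_into (Co W)"
  have A: "A \<in> Co W" and B: "B \<in> Co W"
    using sim_Co[OF AB] sim_Co[OF sim_sym[OF AB]] .
  have Co_ne: "Co W \<noteq> {}"
    using A by blast
  have c: "c n \<in> Co W" for n
    unfolding c_def by (rule from_nat_into[OF Co_ne])
  have c_surj: "\<exists>n. c n = C" if "C \<in> Co W" for C
    unfolding c_def by (rule from_nat_into_surj[OF countable_Co that])
  (* c n runs through all compact open sets; its traces on A and on B become a first and a second
     component at stage n. *)
  let ?P = "\<lambda>(n::nat) F. finite F \<and> matches A B F \<and> F \<subseteq> below A \<times> below B"
  let ?Q = "\<lambda>n F F'. F \<subseteq> F' \<and> (\<exists>D. (c n \<inter> A, D) \<in> F') \<and> (\<exists>C. (C, c n \<inter> B) \<in> F')"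
  have "\<exists>f. \<forall>n. ?P n (f n) \<and> ?Q n (f n) (f (Suc n))"
  proof (rule dependent_nat_choice)
    have "?P 0 {}" using AB by (simp add: matches_def)
    then show "\<exists>F. ?P 0 F" by (rule exI)
    fix F n assume F: "?P n F"
    have cA: "c n \<inter> A \<in> Co W" and cB: "c n \<inter> B \<in> Co W"
      using c A B Co_Int by auto
    obtain D where D: "D \<in> below B" "matches A B (insert (c n \<inter> A, D) F)"
      using matches_extend[OF _ _ cA, of F A B] F by auto
    obtain C where C: "C \<in> below A" "matches A B (insert (C, c n \<inter> B) (insert (c n \<inter> A, D) F))"
      using matches_extend_converse[OF _ D(2) cB] F by auto
    let ?F' = "insert (C, c n \<inter> B) (insert (c n \<inter> A, D) F)"
    have "?P (Suc n) ?F' \<and> ?Q n F ?F'"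
      using F C D cA cB by auto
    then show "\<exists>F'. ?P (Suc n) F' \<and> ?Q n F F'" by (rule exI)
  qed
  then obtain f where f: "\<forall>n. ?P n (f n) \<and> ?Q n (f n) (f (Suc n))"
    by (rule exE)
  have f_good: "?P n (f n)" and f_step: "?Q n (f n) (f (Suc n))" for n
    by (rule conjunct1[OF spec[OF f]], rule conjunct2[OF spec[OF f]])
  have f_matches: "matches A B (f n)" and f_below: "f n \<subseteq> below A \<times> below B"
    and f_inc: "f n \<subseteq> f (Suc n)" for n
    by (rule f_good[THEN conjunct2, THEN conjunct1], rule f_good[THEN conjunct2, THEN conjunct2],
      rule f_step[THEN conjunct1])
  define G where "G = (\<Union>n. f n)"
  have mono: "f m \<subseteq> f n" if "m \<le> n" for m n
    using f_inc that by (rule lift_Suc_mono_le)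
  have G_stage: "\<exists>n. p \<in> f n \<and> q \<in> f n \<and> r \<in> f n" if pqr: "p \<in> G" "q \<in> G" "r \<in> G" for p q r
  proof -
    obtain i j k where "p \<in> f i" "q \<in> f j" "r \<in> f k"
      using pqr by (auto simp: G_def)
    moreover have "f i \<subseteq> f (i + j + k)" "f j \<subseteq> f (i + j + k)" "f k \<subseteq> f (i + j + k)"
      by (simp_all add: mono)
    ultimately have "p \<in> f (i + j + k)" "q \<in> f (i + j + k)" "r \<in> f (i + j + k)"
      by (simp_all add: subsetD)
    then show ?thesis by blast
  qed
  have transfer: "\<exists>x\<in>A. (x \<in> C1 \<longleftrightarrow> y \<in> D1) \<and> (x \<in> C2 \<longleftrightarrow> y \<in> D2) \<and> (x \<in> C3 \<longleftrightarrow> y \<in> D3)"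
    if G: "(C1, D1) \<in> G" "(C2, D2) \<in> G" "(C3, D3) \<in> G" and y: "y \<in> B" for C1 D1 C2 D2 C3 D3 y
  proof -
    from G_stage[OF G] obtain n where n: "(C1, D1) \<in> f n" "(C2, D2) \<in> f n" "(C3, D3) \<in> f n"
      by (elim exE conjE)
    from matches_realize[OF f_matches[of n] y] obtain x
      where x: "x \<in> A" "\<forall>p\<in>f n. x \<in> fst p \<longleftrightarrow> y \<in> snd p"
      by (elim bexE)
    show ?thesis
      using bspec[OF x(2) n(1)] bspec[OF x(2) n(2)] bspec[OF x(2) n(3)]
      by (intro bexI[OF _ x(1)]) simp
  qed
  have transfer': "\<exists>y\<in>B. (x \<in> C1 \<longleftrightarrow> y \<in> D1) \<and> (x \<in> C2 \<longleftrightarrow> y \<in> D2)"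
    if G: "(C1, D1) \<in> G" "(C2, D2) \<in> G" and x: "x \<in> A" for C1 D1 C2 D2 x
  proof -
    from G_stage[OF G G(2)] obtain n where n: "(C1, D1) \<in> f n" "(C2, D2) \<in> f n"
      by (elim exE conjE)
    from matches_realize_converse[OF f_matches[of n] x] obtain y
      where y: "y \<in> B" "\<forall>p\<in>f n. x \<in> fst p \<longleftrightarrow> y \<in> snd p"
      by (elim bexE)
    show ?thesis
      using bspec[OF y(2) n(1)] bspec[OF y(2) n(2)] by (intro bexI[OF _ y(1)]) simp
  qed
  have G_sub: "G \<subseteq> below A \<times> below B"
    unfolding G_def using f_below by (rule UN_least)
  have G_below: "C \<in> below A" "D \<in> below B" if "(C, D) \<in> G" for C D
    by (rule SigmaD1[OF subsetD[OF G_sub that]], rule SigmaD2[OF subsetD[OF G_sub that]])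
  have unique: "C = C' \<longleftrightarrow> D = D'" if G: "(C, D) \<in> G" "(C', D') \<in> G" for C D C' D'
  proof
    assume "C = C'"
    then have "y \<in> D \<longleftrightarrow> y \<in> D'" if "y \<in> B" for y
      using transfer[OF G G(2) that] by auto
    then show "D = D'" using G_below[OF G(1)] G_below[OF G(2)] by blast
  next
    assume "D = D'"
    then have "x \<in> C \<longleftrightarrow> x \<in> C'" if "x \<in> A" for x
      using transfer'[OF G that] by auto
    then show "C = C'" using G_below[OF G(1)] G_below[OF G(2)] by blast
  qed
  have total: "\<exists>D. (C, D) \<in> G" if C: "C \<in> below A" for C
  proof -
    obtain n where "c n = C" using c_surj[of C] C by blast
    then have "c n \<inter> A = C" using C by blast
    then show ?thesis using f_step[of n] by (auto simp: G_def)
  qed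
  have onto: "\<exists>C. (C, D) \<in> G" if D: "D \<in> below B" for D
  proof -
    obtain n where "c n = D" using c_surj[of D] D by blast
    then have "c n \<inter> B = D" using D by blast
    then show ?thesis using f_step[of n] by (auto simp: G_def)
  qed
  define \<phi> where "\<phi> C = (SOME D. (C, D) \<in> G)" for C
  have \<phi>: "(C, \<phi> C) \<in> G" if "C \<in> below A" for C
    unfolding \<phi>_def by (rule someI_ex[OF total[OF that]])
  have \<phi>_below: "\<phi> C \<in> below B" if "C \<in> below A" for C
    by (rule G_below(2)[OF \<phi>[OF that]])
  have inj: "inj_on \<phi> (below A)"
  proof (rule inj_onI)
    fix C C' assume C: "C \<in> below A" "C' \<in> below A" "\<phi> C = \<phi> C'"
    show "C = C'" using unique[OF \<phi>[OF C(1)] \<phi>[OF C(2)]] C(3) by (rule iffD2)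
  qed
  have "\<phi> ` below A = below B"
  proof (rule equalityI; rule subsetI)
    fix D assume "D \<in> \<phi> ` below A"
    then obtain C where C: "D = \<phi> C" "C \<in> below A" by (rule imageE)
    show "D \<in> below B" unfolding C(1) by (rule \<phi>_below[OF C(2)])
  next
    fix D assume D: "D \<in> below B"
    from onto[OF D] obtain C where C: "(C, D) \<in> G" by (elim exE)
    have "D = \<phi> C" using unique[OF C \<phi>[OF G_below(1)[OF C]]] by simp
    then show "D \<in> \<phi> ` below A" using G_below(1)[OF C] by (rule image_eqI)
  qed
  with inj have bij: "bij_betw \<phi> (below A) (below B)"
    by (rule bij_betw_imageI)
  have hom: "\<phi> (C \<inter> C') = \<phi> C \<inter> \<phi> C'" "\<phi> (sym_diff C C') = sym_diff (\<phi> C) (\<phi> C')"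
    if C: "C \<in> below A" "C' \<in> below A" for C C'
  proof -
    have I: "C \<inter> C' \<in> below A" and S: "sym_diff C C' \<in> below A"
      using C Co_Int Co_Un Co_Diff by auto
    have "y \<in> \<phi> (C \<inter> C') \<longleftrightarrow> y \<in> \<phi> C \<inter> \<phi> C'" if "y \<in> B" for y
      using transfer[OF \<phi>[OF C(1)] \<phi>[OF C(2)] \<phi>[OF I] that] by auto
    then show "\<phi> (C \<inter> C') = \<phi> C \<inter> \<phi> C'"
      using \<phi>_below[OF C(1)] \<phi>_below[OF I] by blast
    have "y \<in> \<phi> (sym_diff C C') \<longleftrightarrow> y \<in> sym_diff (\<phi> C) (\<phi> C')" if "y \<in> B" for y
      using transfer[OF \<phi>[OF C(1)] \<phi>[OF C(2)] \<phi>[OF S] that] by auto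
    then show "\<phi> (sym_diff C C') = sym_diff (\<phi> C) (\<phi> C')"
      using \<phi>_below[OF C(1)] \<phi>_below[OF C(2)] \<phi>_below[OF S] by blast
  qed
  have A': "A \<in> below A" using A by simp
  have "y \<in> \<phi> A" if "y \<in> B" for y
    using transfer[OF \<phi>[OF A'] \<phi>[OF A'] \<phi>[OF A'] that] by auto
  then have one: "\<phi> A = B"
    using \<phi>_below[OF A'] by blast
  have "\<phi> \<in> ring_hom (principal_ideal W A) (principal_ideal W B)"
    using \<phi>_below hom one by (intro ring_hom_memI) (simp_all add: principal_ideal_def)
  then have "\<phi> \<in> ring_iso (principal_ideal W A) (principal_ideal W B)"
    using bij by (simp add: ring_iso_def principal_ideal_def)
  then show ?thesis unfolding is_ring_iso_def by blast
qed

end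

section \<open>Types of points\<close>

locale cji_basis = stone +
  fixes V :: "'a set set"
  assumes subalgebra: "complete_heyting_star_subalgebra W V"
    and basis: "basis_for (cji V) V"
begin

lemma V_open: "U \<in> V \<Longrightarrow> openin W U"
  using subalgebra by (auto simp: complete_heyting_star_subalgebra_def)

lemma V_Union: "E \<subseteq> V \<Longrightarrow> \<Union>E \<in> V"
  using subalgebra by (simp add: complete_heyting_star_subalgebra_def)

lemma V_inf: "E \<subseteq> V \<Longrightarrow> open_inf W E \<in> V"
  using subalgebra by (simp add: complete_heyting_star_subalgebra_def)

lemma V_imp: "I \<in> V \<Longrightarrow> J \<in> V \<Longrightarrow> open_imp W I J \<in> V"
  using subalgebra by (simp add: complete_heyting_star_subalgebra_def)

lemma V_star: "I \<in> V \<Longrightarrow> open_star W I \<in> V"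
  using subalgebra by (simp add: complete_heyting_star_subalgebra_def)

lemma V_Int:
  assumes "I \<in> V" "J \<in> V"
  shows "I \<inter> J \<in> V"
proof -
  have "topspace W \<inter> \<Inter>{I, J} = I \<inter> J"
    using openin_subset[OF V_open[OF assms(1)]] by auto
  moreover have "openin W (I \<inter> J)"
    using assms V_open by blast
  ultimately have "open_inf W {I, J} = I \<inter> J"
    by (simp add: open_inf_def interior_of_openin)
  then show ?thesis
    using V_inf[of "{I, J}"] assms by simp
qed

definition lower :: "'a set \<Rightarrow> 'a set" where
  "lower K = \<Union>{L \<in> V. L \<subset> K}"

text \<open>The points of type \<open>K\<close>: for \<open>K\<close> completely join irreducible, those whose least neighbourhood
  in \<open>V\<close> is \<open>K\<close>.\<close>

definition core :: "'a set \<Rightarrow> 'a set" where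
  "core K = K - lower K"

lemma lower_in_V: "lower K \<in> V"
  unfolding lower_def by (rule V_Union) blast

lemma cji_in_V: "K \<in> cji V \<Longrightarrow> K \<in> V"
  by (simp add: cji_def)

lemma cji_Union: "K \<in> cji V \<Longrightarrow> E \<subseteq> V \<Longrightarrow> K \<subseteq> \<Union>E \<Longrightarrow> \<exists>I\<in>E. K \<subseteq> I"
  by (simp add: cji_def)

lemma core_nonempty:
  assumes "K \<in> cji V"
  shows "\<not> K \<subseteq> lower K"
proof
  assume "K \<subseteq> lower K"
  then have "\<exists>I\<in>{L \<in> V. L \<subset> K}. K \<subseteq> I"
    unfolding lower_def by (intro cji_Union[OF assms]) auto
  then show False by blast
qed

lemma core_least:
  assumes K: "K \<in> cji V" and x: "x \<in> core K" and L: "L \<in> V" "x \<in> L"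
  shows "K \<subseteq> L"
proof (rule ccontr)
  assume "\<not> K \<subseteq> L"
  then have "K \<inter> L \<subset> K" by blast
  then have "K \<inter> L \<subseteq> lower K"
    unfolding lower_def using V_Int[OF cji_in_V[OF K] L(1)] by blast
  then show False using x L(2) by (auto simp: core_def)
qed

text \<open>The star operation separates two kinds of types: \<open>K\<close> meets \<open>open_star W (lower K)\<close> in
  \<open>lower K\<close> together with the isolated points of \<open>core K\<close>, and since no member of \<open>V\<close> lies
  strictly between \<open>lower K\<close> and \<open>K\<close>, either all points of \<open>core K\<close> are isolated in it or none is.\<close>

definition discrete_core :: "'a set \<Rightarrow> bool" where
  "discrete_core K \<longleftrightarrow> K \<subseteq> open_star W (lower K)"

lemma discrete_core_isolated:
  assumes K: "K \<in> cji V" and d: "discrete_core K" and y: "y \<in> core K"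
  obtains N where "openin W N" "y \<in> N" "N \<inter> core K \<subseteq> {y}"
proof -
  have sub: "K \<subseteq> topspace W"
    using openin_subset[OF V_open[OF cji_in_V[OF K]]] .
  have "y \<in> open_star W (lower K)"
    using d y by (auto simp: discrete_core_def core_def)
  then obtain T where T: "openin W T" "y \<in> T"
      "\<not> (\<exists>z. z \<noteq> y \<and> z \<in> topspace W - lower K \<and> z \<in> T)"
    unfolding open_star_def by (auto simp: in_derived_set_of)
  have "T \<inter> core K \<subseteq> {y}"
    using T(3) sub by (auto simp: core_def)
  then show thesis using that T(1,2) by blast
qed

lemma perfect_core_accumulates:
  assumes K: "K \<in> cji V" and d: "\<not> discrete_core K" and y: "y \<in> core K"
    and T: "openin W T" "y \<in> T"
  obtains z where "z \<in> core K" "z \<in> T" "z \<noteq> y"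
proof -
  have sub: "K \<subseteq> topspace W"
    using openin_subset[OF V_open[OF cji_in_V[OF K]]] .
  have yK: "y \<in> K" using y by (simp add: core_def)
  have "y \<notin> open_star W (lower K)"
    using core_least[OF K y V_star[OF lower_in_V]] d by (auto simp: discrete_core_def)
  then have "y \<in> W derived_set_of (topspace W - lower K)"
    using yK sub by (auto simp: open_star_def)
  moreover have "openin W (T \<inter> K)" "y \<in> T \<inter> K"
    using T V_open[OF cji_in_V[OF K]] yK by auto
  ultimately obtain z where "z \<noteq> y" "z \<in> topspace W - lower K" "z \<in> T \<inter> K"
    unfolding in_derived_set_of by blast
  then show thesis
    using that[of z] by (simp add: core_def)
qed

section \<open>Trim sets\<close>

text \<open>Outside \<open>lower K\<close>, a trim set of type \<open>K\<close> has a single point if \<open>core K\<close> is discrete and a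
  perfect set otherwise. These sets turn out to be determined by \<open>K\<close> up to isomorphism; without
  the restriction to one point, the number of points would be a further invariant.\<close>

definition trim :: "'a set \<Rightarrow> 'a set \<Rightarrow> bool" where
  "trim K A \<longleftrightarrow> A \<in> Co W \<and> K \<in> cji V \<and> A \<subseteq> K \<and> A \<inter> core K \<noteq> {} \<and>
     (discrete_core K \<longrightarrow> (\<forall>x\<in>A \<inter> core K. \<forall>y\<in>A \<inter> core K. x = y))"

lemma trim_subset:
  assumes "trim K A" "C \<in> Co W" "C \<subseteq> A" "C \<inter> core K \<noteq> {}"
  shows "trim K C"
  using assms unfolding trim_def by (auto 4 3)

lemma trim_nbhd:
  assumes L: "L \<in> cji V" and z: "z \<in> core L" and U: "openin W U" "z \<in> U"
  obtains D where "trim L D" "z \<in> D" "D \<subseteq> U"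
proof -
  have "\<exists>N. openin W N \<and> z \<in> N \<and> (discrete_core L \<longrightarrow> N \<inter> core L \<subseteq> {z})"
  proof (cases "discrete_core L")
    case True
    then show ?thesis using discrete_core_isolated[OF L True z] by metis
  next
    case False
    then show ?thesis using U by blast
  qed
  then obtain N where N: "openin W N" "z \<in> N" "discrete_core L \<longrightarrow> N \<inter> core L \<subseteq> {z}"
    by (elim exE conjE)
  have "openin W (U \<inter> L \<inter> N)" "z \<in> U \<inter> L \<inter> N"
    using U N z V_open[OF cji_in_V[OF L]] by (auto simp: core_def)
  then obtain D where D: "D \<in> Co W" "z \<in> D" "D \<subseteq> U \<inter> L \<inter> N"
    by (rule Co_nbhd)
  have "discrete_core L \<longrightarrow> (\<forall>x\<in>D \<inter> core L. \<forall>y\<in>D \<inter> core L. x = y)"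
    using N(3) D(3) by blast
  then have "trim L D"
    using D L z unfolding trim_def by auto
  then show thesis using that[of D] D(2,3) by simp
qed

text \<open>If \<open>B\<close> had no point of type \<open>L\<close> then \<open>B\<close> would lie in the member
  \<open>open_imp W L (lower L)\<close> of \<open>V\<close>, hence so would the least member \<open>K\<close> around its points of type
  \<open>K\<close>, hence so would \<open>L\<close>.\<close>

lemma trim_meets_lower_types:
  assumes B: "trim K B" and L: "L \<in> cji V" "L \<subseteq> K"
  shows "B \<inter> core L \<noteq> {}"
proof
  assume no: "B \<inter> core L = {}"
  let ?I = "open_imp W L (lower L)"
  have BCo: "B \<in> Co W" and K: "K \<in> cji V"
    using B by (simp_all add: trim_def)
  have "B \<subseteq> ?I"
    unfolding open_imp_def using no Co_open[OF BCo] Co_subset[OF BCo]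
    by (intro interior_of_maximal) (auto simp: core_def)
  moreover obtain y where "y \<in> B" "y \<in> core K"
    using B by (auto simp: trim_def)
  ultimately have "K \<subseteq> ?I"
    using core_least[OF K _ V_imp[OF cji_in_V[OF L(1)] lower_in_V]] by blast
  then have "L \<subseteq> (topspace W - L) \<union> lower L"
    using L(2) interior_of_subset[of W "(topspace W - L) \<union> lower L"] unfolding open_imp_def by blast
  then show False using core_nonempty[OF L(1)] by blast
qed

text \<open>For \<open>L \<noteq> K\<close> a trim set of type \<open>L\<close> lies in \<open>lower K\<close>, so its removal keeps all points of type \<open>K\<close>.
  For \<open>L = K\<close> with a perfect core, one of two points of type \<open>K\<close> is removed with a neighbourhood
  and the other one stays.\<close>

lemma trim_remove:
  assumes B: "trim K B" and L: "L \<in> cji V" "L \<subseteq> K" and KL: "\<not> (L = K \<and> discrete_core K)"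
  shows "\<exists>D\<subseteq>B. trim L D \<and> trim K (B - D)"
proof (cases "L = K")
  case False
  then have low: "L \<subseteq> lower K"
    using L cji_in_V[OF L(1)] by (auto simp: lower_def)
  obtain z where z: "z \<in> B" "z \<in> core L"
    using trim_meets_lower_types[OF B L] by blast
  have BCo: "B \<in> Co W" using B by (simp add: trim_def)
  obtain D where D: "trim L D" "z \<in> D" "D \<subseteq> B"
    using trim_nbhd[OF L(1) z(2) Co_open[OF BCo] z(1)] .
  have DCo: "D \<in> Co W" and DL: "D \<subseteq> L" using D(1) by (simp_all add: trim_def)
  have "(B - D) \<inter> core K = B \<inter> core K"
    using DL low by (auto simp: core_def)
  then have "trim K (B - D)"
    using trim_subset[OF B Co_Diff[OF BCo DCo] Diff_subset] B by (simp add: trim_def)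
  then show ?thesis using D by blast
next
  case True
  then have perf: "\<not> discrete_core K" using KL by simp
  have BCo: "B \<in> Co W" and K: "K \<in> cji V" using B by (simp_all add: trim_def)
  obtain y where y: "y \<in> B" "y \<in> core K"
    using B by (auto simp: trim_def)
  obtain z where z: "z \<in> core K" "z \<in> B" "z \<noteq> y"
    using perfect_core_accumulates[OF K perf y(2) Co_open[OF BCo] y(1)] .
  obtain C where C: "C \<in> below B" "z \<in> C" "y \<notin> C"
    using Co_separates[OF BCo z(2) y(1) z(3)] .
  have "openin W C" using C(1) Co_open by simp
  then obtain D where D: "trim K D" "z \<in> D" "D \<subseteq> C"
    using trim_nbhd[OF K z(1) _ C(2)] by metis
  have DCo: "D \<in> Co W" using D(1) by (simp add: trim_def)
  have "y \<in> (B - D) \<inter> core K" using y D(3) C(3) by auto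
  then have "trim K (B - D)"
    using trim_subset[OF B Co_Diff[OF BCo DCo] Diff_subset] by blast
  moreover have "D \<subseteq> B" using D(3) C(1) by auto
  ultimately show ?thesis using D(1) True by blast
qed

definition trim_sum :: "'a set \<Rightarrow> bool" where
  "trim_sum A \<longleftrightarrow> (\<exists>F. finite F \<and> disjoint F \<and> (\<forall>X\<in>F. \<exists>L. trim L X) \<and> \<Union>F = A)"

lemma trim_sum_UN:
  assumes "finite I" "disjoint_family_on g I" "\<And>i. i \<in> I \<Longrightarrow> trim_sum (g i)"
  shows "trim_sum (\<Union>i\<in>I. g i)"
proof -
  have "\<forall>i\<in>I. \<exists>F. finite F \<and> disjoint F \<and> (\<forall>X\<in>F. \<exists>L. trim L X) \<and> \<Union>F = g i"
    using assms(3) by (simp add: trim_sum_def)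
  from bchoice[OF this] obtain F where
    F: "\<forall>i\<in>I. finite (F i) \<and> disjoint (F i) \<and> (\<forall>X\<in>F i. \<exists>L. trim L X) \<and> \<Union>(F i) = g i"
    by (elim exE)
  have "disjoint (\<Union>i\<in>I. F i)"
  proof (rule disjointI)
    fix X Y assume X: "X \<in> (\<Union>i\<in>I. F i)" and Y: "Y \<in> (\<Union>i\<in>I. F i)" and ne: "X \<noteq> Y"
    obtain i where i: "i \<in> I" "X \<in> F i" using X by (rule UN_E)
    obtain j where j: "j \<in> I" "Y \<in> F j" using Y by (rule UN_E)
    show "X \<inter> Y = {}"
    proof (cases "i = j")
      case True
      have "disjoint (F j)" using F j(1) by simp
      then show ?thesis using i(2) j(2) ne True by (auto simp: disjoint_def)
    next
      case False
      then have "g i \<inter> g j = {}"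
        using assms(2) i(1) j(1) by (simp add: disjoint_family_on_def)
      moreover have "X \<subseteq> g i" "Y \<subseteq> g j"
        using F i j by auto
      ultimately show ?thesis by blast
    qed
  qed
  moreover have "finite (\<Union>i\<in>I. F i)" "\<forall>X\<in>(\<Union>i\<in>I. F i). \<exists>L. trim L X"
    using F assms(1) by auto
  moreover have "\<Union>(\<Union>i\<in>I. F i) = (\<Union>i\<in>I. g i)"
  proof -
    have "\<Union>(\<Union>i\<in>I. F i) = (\<Union>i\<in>I. \<Union>(F i))" by blast
    also have "\<dots> = (\<Union>i\<in>I. g i)" using F by simp
    finally show ?thesis .
  qed
  ultimately show ?thesis unfolding trim_sum_def by (intro exI[of _ "\<Union>i\<in>I. F i"]) simp
qed

lemma trim_imp_trim_sum: "trim K A \<Longrightarrow> trim_sum A"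
  unfolding trim_sum_def by (intro exI[of _ "{A}"]) auto

text \<open>When \<open>core K\<close> is discrete, the open sets \<open>lower K \<union> N\<close>, with \<open>N\<close> isolating one point of
  \<open>core K\<close>, cover \<open>A\<close>; each is the only one to contain its point, so a subordinate partition
  distributes these points one by one.\<close>

lemma trim_sum_one_type:
  assumes A: "A \<in> Co W" and K: "K \<in> cji V" and AK: "A \<subseteq> K" and ne: "A \<inter> core K \<noteq> {}"
  shows "trim_sum A"
proof (cases "discrete_core K")
  case False
  then have "trim K A" using assms by (simp add: trim_def)
  then show ?thesis by (rule trim_imp_trim_sum)
next
  case True
  have "\<exists>N. openin W N \<and> y \<in> N \<and> N \<inter> core K \<subseteq> {y}" if "y \<in> A \<inter> core K" for y
    using discrete_core_isolated[OF K True, of y] that by (metis IntD2)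
  then have "\<forall>y\<in>A \<inter> core K. \<exists>N. openin W N \<and> y \<in> N \<and> N \<inter> core K \<subseteq> {y}"
    by (rule ballI)
  from bchoice[OF this] obtain N
    where N: "\<forall>y\<in>A \<inter> core K. openin W (N y) \<and> y \<in> N y \<and> N y \<inter> core K \<subseteq> {y}"
    by (elim exE)
  define \<U> where "\<U> = (\<lambda>y. lower K \<union> N y) ` (A \<inter> core K)"
  have op: "openin W U" if "U \<in> \<U>" for U
    using that N V_open[OF lower_in_V] by (auto simp: \<U>_def)
  have cov: "A \<subseteq> \<Union>\<U>"
  proof
    fix x assume x: "x \<in> A"
    show "x \<in> \<Union>\<U>"
    proof (cases "x \<in> lower K")
      case True
      then show ?thesis using ne by (auto simp: \<U>_def)
    next
      case False
      then have "x \<in> A \<inter> core K" using x AK by (auto simp: core_def)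
      moreover have "x \<in> N x" using N calculation by simp
      ultimately show ?thesis unfolding \<U>_def by blast
    qed
  qed
  have "compactin W A" using A by (simp add: Co_def)
  then have "\<exists>\<F>. finite \<F> \<and> \<F> \<subseteq> \<U> \<and> A \<subseteq> \<Union>\<F>"
    using op cov by (intro compactinD)
  then obtain \<F> where \<F>: "finite \<F>" "\<F> \<subseteq> \<U>" "A \<subseteq> \<Union>\<F>"
    by (elim exE conjE)
  have "\<exists>g. (\<forall>U\<in>\<F>. g U \<in> Co W \<and> g U \<subseteq> U) \<and> disjoint_family_on g \<F> \<and> (\<Union>U\<in>\<F>. g U) = A"
    using op \<F> by (intro partition_subordinate A) auto
  then obtain g where g: "\<forall>U\<in>\<F>. g U \<in> Co W \<and> g U \<subseteq> U" "disjoint_family_on g \<F>"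
      "(\<Union>U\<in>\<F>. g U) = A"
    by (elim exE conjE)
  have only: "y = y'" if "y \<in> A \<inter> core K" "y' \<in> A \<inter> core K" "y' \<in> lower K \<union> N y" for y y'
    using that bspec[OF N that(1)] by (auto simp: core_def)
  have "trim K (g U)" if U: "U \<in> \<F>" for U
  proof -
    have gA: "g U \<subseteq> A" using g(3) U by blast
    obtain y where y: "y \<in> A \<inter> core K" "U = lower K \<union> N y"
      using U \<F>(2) by (auto simp: \<U>_def)
    obtain U' where U': "U' \<in> \<F>" "y \<in> g U'"
      using g(3) y(1) by blast
    obtain y' where y': "y' \<in> A \<inter> core K" "U' = lower K \<union> N y'"
      using U' \<F>(2) by (auto simp: \<U>_def)
    have "y \<in> U'" using g(1) U' by blast
    then have "y' = y" using only[OF y'(1) y(1)] y'(2) by simp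
    then have "y \<in> g U" using y y' U'(2) by simp
    moreover have "x = y" if "x \<in> g U \<inter> core K" for x
    proof -
      have "x \<in> U" using g(1) U that by blast
      then show ?thesis using only[OF y(1), of x] that gA y(2) by auto
    qed
    moreover have "g U \<in> Co W" using g(1) U by simp
    ultimately show ?thesis
      unfolding trim_def using K AK gA y(1) by auto
  qed
  then have "trim_sum (g U)" if "U \<in> \<F>" for U
    using that by (intro trim_imp_trim_sum)
  then have "trim_sum (\<Union>U\<in>\<F>. g U)"
    by (rule trim_sum_UN[OF \<F>(1) g(2)])
  then show ?thesis using g(3) by simp
qed

text \<open>The least member \<open>J\<close> of \<open>V\<close> containing \<open>A\<close> is, by compactness, a finite union of completely
  join irreducible ones. Taking as few as possible and partitioning \<open>A\<close> accordingly, the part in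
  \<open>K\<close> contains points of type \<open>K\<close>: otherwise \<open>A\<close>, hence \<open>J\<close>, hence \<open>K\<close> would be covered by
  \<open>lower K\<close> and the other members, and \<open>K\<close> would be superfluous.\<close>

theorem Co_trim_sum:
  assumes A: "A \<in> Co W"
  shows "trim_sum A"
proof -
  obtain J where J: "J \<in> V" and AJ: "A \<subseteq> J"
    and J_min: "\<forall>I\<in>V. A \<subseteq> I \<longrightarrow> J \<subseteq> I"
    using least_member[OF subalgebra A] .
  have least: "J \<subseteq> I" if "I \<in> V" "A \<subseteq> I" for I
    using J_min that by simp
  let ?P = "\<lambda>\<K>. finite \<K> \<and> \<K> \<subseteq> cji V \<and> A \<subseteq> \<Union>\<K> \<and> \<Union>\<K> \<subseteq> J"
  obtain E where E: "E \<subseteq> cji V" "J = \<Union>E"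
    using basis J by (auto simp: basis_for_def)
  have "compactin W A" using A by (simp add: Co_def)
  moreover have "openin W U" if "U \<in> E" for U
    using that E(1) cji_in_V V_open by blast
  moreover have "A \<subseteq> \<Union>E" using AJ E(2) by simp
  ultimately have "\<exists>\<K>. finite \<K> \<and> \<K> \<subseteq> E \<and> A \<subseteq> \<Union>\<K>"
    by (intro compactinD)
  then obtain \<K>0 where "finite \<K>0" "\<K>0 \<subseteq> E" "A \<subseteq> \<Union>\<K>0"
    by (elim exE conjE)
  then have "?P \<K>0" using E by auto
  from ex_has_least_nat[of ?P, OF this, of card] obtain \<K>
    where \<K>: "?P \<K>" and min: "\<forall>\<L>. ?P \<L> \<longrightarrow> card \<K> \<le> card \<L>"
    by (elim exE conjE) simp
  have fin: "finite \<K>" and sub: "\<K> \<subseteq> cji V" and cov: "A \<subseteq> \<Union>\<K>" and ltJ: "\<Union>\<K> \<subseteq> J"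
    using \<K> by simp_all
  have "\<exists>g. (\<forall>U\<in>\<K>. g U \<in> Co W \<and> g U \<subseteq> U) \<and> disjoint_family_on g \<K> \<and> (\<Union>U\<in>\<K>. g U) = A"
    using sub cji_in_V V_open by (intro partition_subordinate fin A cov) auto
  then obtain g where g: "\<forall>U\<in>\<K>. g U \<in> Co W \<and> g U \<subseteq> U" "disjoint_family_on g \<K>"
      "(\<Union>U\<in>\<K>. g U) = A"
    by (elim exE conjE)
  have "g K \<inter> core K \<noteq> {}" if K: "K \<in> \<K>" for K
  proof
    assume no: "g K \<inter> core K = {}"
    have Kc: "K \<in> cji V" using sub K by blast
    have gK: "g K \<subseteq> lower K"
      using no bspec[OF g(1) K] by (auto simp: core_def)
    let ?E = "insert (lower K) (\<K> - {K})"
    have EV: "?E \<subseteq> V" using lower_in_V sub cji_in_V by auto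
    have "A \<subseteq> \<Union>?E"
    proof
      fix x assume "x \<in> A"
      then obtain L where L: "L \<in> \<K>" "x \<in> g L" using g(3) by blast
      show "x \<in> \<Union>?E"
      proof (cases "L = K")
        case True
        then show ?thesis using L(2) gK by auto
      next
        case False
        then show ?thesis using L bspec[OF g(1) L(1)] by auto
      qed
    qed
    then have "J \<subseteq> \<Union>?E" by (rule least[OF V_Union[OF EV]])
    then have "K \<subseteq> \<Union>?E" using ltJ K by blast
    then have "\<exists>I\<in>?E. K \<subseteq> I" by (rule cji_Union[OF Kc EV])
    then obtain L where L: "L \<in> \<K> - {K}" "K \<subseteq> L"
      using core_nonempty[OF Kc] by auto
    have "\<Union>\<K> \<subseteq> \<Union>(\<K> - {K})"
      using L by blast
    then have "?P (\<K> - {K})"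
      using fin sub cov ltJ by auto
    then have "card \<K> \<le> card (\<K> - {K})" using min by simp
    then show False using card_Diff1_less[OF fin K] by simp
  qed
  then have "trim_sum (g K)" if "K \<in> \<K>" for K
    using that g(1) sub by (intro trim_sum_one_type[of _ K]) auto
  then have "trim_sum (\<Union>U\<in>\<K>. g U)"
    by (rule trim_sum_UN[OF fin g(2)])
  then show ?thesis using g(3) by simp
qed

section \<open>Uniqueness of trim sets\<close>

text \<open>A part of a trim set need not be trim, only a disjoint sum of trim sets; so the back-and-forth
  relation has to compare disjoint sums whose summands agree in type.\<close>

inductive sim :: "'a set \<Rightarrow> 'a set \<Rightarrow> bool" where
  empty: "sim {} {}"
| add: "trim K A \<Longrightarrow> trim K B \<Longrightarrow> sim A' B' \<Longrightarrow> A \<inter> A' = {} \<Longrightarrow> B \<inter> B' = {} \<Longrightarrow>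
    sim (A \<union> A') (B \<union> B')"

lemma sim_trim: "trim K A \<Longrightarrow> trim K B \<Longrightarrow> sim A B"
  using sim.add[OF _ _ sim.empty] by simp

lemma sim_in_Co: "sim A B \<Longrightarrow> A \<in> Co W"
  by (induction rule: sim.induct) (auto simp: trim_def intro: Co_Un)

lemma sim_commute: "sim A B \<Longrightarrow> sim B A"
  by (induction rule: sim.induct) (auto intro: sim.intros)

lemma sim_empty_iff: "sim A B \<Longrightarrow> A = {} \<longleftrightarrow> B = {}"
  by (induction rule: sim.induct) (auto simp: trim_def)

lemma sim_Un:
  assumes "sim A B" "sim C D" "A \<inter> C = {}" "B \<inter> D = {}"
  shows "sim (A \<union> C) (B \<union> D)"
  using assms
proof (induction rule: sim.induct)
  case empty
  then show ?case by simp
next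
  case (add K A B A' B')
  have "sim (A' \<union> C) (B' \<union> D)"
    using add.IH add.prems by auto
  then have "sim (A \<union> (A' \<union> C)) (B \<union> (B' \<union> D))"
    by (rule sim.add[OF add.hyps(1,2)]) (use add.hyps(4,5) add.prems(2,3) in auto)
  then show ?case by (simp only: Un_assoc)
qed

text \<open>A trim set of type \<open>K\<close> contains a copy of any finite disjoint sum of trim sets of types below
  \<open>K\<close> and remains trim of type \<open>K\<close> without it; type \<open>K\<close> itself may occur in the sum if \<open>core K\<close>
  is not discrete.\<close>

lemma trim_absorbs:
  assumes "finite F" "disjoint F" "trim K B"
    and "\<forall>X\<in>F. \<exists>L. trim L X \<and> L \<subseteq> K \<and> \<not> (L = K \<and> discrete_core K)"
  shows "\<exists>D\<subseteq>B. sim (\<Union>F) D \<and> trim K (B - D)"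
  using assms
proof (induction F rule: finite_induct)
  case empty
  then show ?case using sim.empty by (intro exI[of _ "{}"]) simp
next
  case (insert X F)
  have "disjoint F" using insert.prems(1) by (simp add: pairwise_insert)
  then obtain D1 where D1: "D1 \<subseteq> B" "sim (\<Union>F) D1" "trim K (B - D1)"
    using insert.IH insert.prems by auto
  obtain L where L: "trim L X" "L \<subseteq> K" "\<not> (L = K \<and> discrete_core K)"
    using insert.prems(3) by auto
  have "L \<in> cji V" using L(1) by (simp add: trim_def)
  from trim_remove[OF D1(3) this L(2,3)]
  obtain D2 where D2: "D2 \<subseteq> B - D1" "trim L D2" "trim K (B - D1 - D2)"
    by (elim exE conjE)
  have "X \<inter> \<Union>F = {}"
    using insert.prems(1) insert.hyps(2) by (auto simp: disjoint_def)
  then have "sim (X \<union> \<Union>F) (D2 \<union> D1)"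
    using D2(1) by (intro sim.add[OF L(1) D2(2) D1(2)]) auto
  moreover have "B - (D2 \<union> D1) = B - D1 - D2" by blast
  ultimately show ?case
    using D1(1) D2 by (intro exI[of _ "D2 \<union> D1"]) auto
qed

text \<open>The part \<open>C\<close> is itself trim of type \<open>K\<close>. A copy of the sum \<open>A - C\<close> is taken out of \<open>B\<close>, and what is
  left of \<open>B\<close>, still trim of type \<open>K\<close>, becomes the partner of \<open>C\<close>.\<close>

lemma trim_split_core:
  assumes A: "trim K A" and B: "trim K B" and C: "C \<in> Co W" "C \<subseteq> A" and ne: "C \<inter> core K \<noteq> {}"
  shows "\<exists>D\<subseteq>B. sim C D \<and> sim (A - C) (B - D)"
proof -
  have ACo: "A \<in> Co W" and K: "K \<in> cji V" and AK: "A \<subseteq> K"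
    using A by (simp_all add: trim_def)
  obtain F where F: "finite F" "disjoint F" "\<forall>X\<in>F. \<exists>L. trim L X" "\<Union>F = A - C"
    using Co_trim_sum[OF Co_Diff[OF ACo C(1)]] unfolding trim_sum_def by (elim exE conjE)
  have types: "\<forall>X\<in>F. \<exists>L. trim L X \<and> L \<subseteq> K \<and> \<not> (L = K \<and> discrete_core K)"
  proof
    fix X assume X: "X \<in> F"
    obtain L where L: "trim L X" using F(3) X by blast
    have XA: "X \<subseteq> A - C" using F(4) X by blast
    obtain z where z: "z \<in> X" "z \<in> core L" using L by (auto simp: trim_def)
    have "L \<in> cji V" using L by (simp add: trim_def)
    from core_least[OF this z(2) cji_in_V[OF K]] have LK: "L \<subseteq> K"
      using z(1) XA AK by blast
    have "\<not> (L = K \<and> discrete_core K)"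
    proof
      assume *: "L = K \<and> discrete_core K"
      obtain y where y: "y \<in> C" "y \<in> core K" using ne by blast
      have "y \<in> A \<inter> core K" "z \<in> A \<inter> core K" using y z XA C(2) * by auto
      then have "y = z" using A * unfolding trim_def by blast
      then show False using y(1) z(1) XA by blast
    qed
    then show "\<exists>L. trim L X \<and> L \<subseteq> K \<and> \<not> (L = K \<and> discrete_core K)"
      using L LK by (intro exI[of _ L]) simp
  qed
  from trim_absorbs[OF F(1,2) B types]
  obtain D where D: "D \<subseteq> B" "sim (\<Union>F) D" "trim K (B - D)"
    by (elim exE conjE)
  have "sim C (B - D)"
    by (rule sim_trim[OF trim_subset[OF A C ne] D(3)])
  moreover have "sim (A - C) (B - (B - D))"
    using D(1,2) F(4) by (simp add: double_diff)
  ultimately show ?thesis by (intro exI[of _ "B - D"]) simp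
qed

lemma trim_split:
  assumes A: "trim K A" and B: "trim K B" and C: "C \<in> Co W" "C \<subseteq> A"
  shows "\<exists>D\<subseteq>B. sim C D \<and> sim (A - C) (B - D)"
proof (cases "C \<inter> core K = {}")
  case False
  then show ?thesis by (rule trim_split_core[OF A B C])
next
  case True
  have ACo: "A \<in> Co W" using A by (simp add: trim_def)
  have "(A - C) \<inter> core K \<noteq> {}"
    using A True by (auto simp: trim_def)
  from trim_split_core[OF A B Co_Diff[OF ACo C(1)] Diff_subset this]
  obtain D where D: "D \<subseteq> B" "sim (A - C) D" "sim (A - (A - C)) (B - D)"
    by (elim exE conjE)
  have "A - (A - C) = C" "B - (B - D) = D" using C(2) D(1) by blast+
  then show ?thesis using D by (intro exI[of _ "B - D"]) simp
qed

lemma sim_split_Co: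
  assumes "sim A B" "C \<in> Co W" "C \<subseteq> A"
  shows "\<exists>D\<subseteq>B. sim C D \<and> sim (A - C) (B - D)"
  using assms
proof (induction arbitrary: C rule: sim.induct)
  case empty
  then show ?case using sim.empty by (intro exI[of _ "{}"]) simp
next
  case (add K A B A' B')
  have Co: "C \<inter> A \<in> Co W" "C \<inter> A' \<in> Co W"
    using add.prems(1) add.hyps(1) sim_in_Co[OF add.hyps(3)] by (simp_all add: trim_def Co_Int)
  obtain D where D: "D \<subseteq> B" "sim (C \<inter> A) D" "sim (A - C \<inter> A) (B - D)"
    using trim_split[OF add.hyps(1,2) Co(1) Int_lower2] by (elim exE conjE)
  obtain D' where D': "D' \<subseteq> B'" "sim (C \<inter> A') D'" "sim (A' - C \<inter> A') (B' - D')"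
    using add.IH[OF Co(2) Int_lower2] by (elim exE conjE)
  have "sim ((C \<inter> A) \<union> (C \<inter> A')) (D \<union> D')"
    using sim_Un[OF D(2) D'(2)] add.hyps(4,5) D(1) D'(1) by blast
  moreover have "(C \<inter> A) \<union> (C \<inter> A') = C"
    using add.prems(2) by blast
  moreover have "sim ((A - C \<inter> A) \<union> (A' - C \<inter> A')) ((B - D) \<union> (B' - D'))"
    using sim_Un[OF D(3) D'(3)] add.hyps(4,5) by blast
  moreover have "(A - C \<inter> A) \<union> (A' - C \<inter> A') = (A \<union> A') - C"
    by blast
  moreover have "(B - D) \<union> (B' - D') = (B \<union> B') - (D \<union> D')"
    using D(1) D'(1) add.hyps(5) by blast
  ultimately show ?case
    using D(1) D'(1) by (intro exI[of _ "D \<union> D'"]) auto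
qed

lemma trim_iso:
  assumes "countable (Co W)" "trim K A" "trim K B"
  shows "principal_ideal W A \<simeq> principal_ideal W B"
proof -
  interpret vaught_relation W sim
    using assms(1) sim_in_Co sim_commute sim_empty_iff sim_split_Co by unfold_locales
  show ?thesis using sim_imp_iso[OF sim_trim[OF assms(2,3)]] .
qed

text \<open>When a trim set is split in two, a part with points of type \<open>K\<close> is again trim of type \<open>K\<close>.\<close>

lemma trim_PI:
  assumes cnt: "countable (Co W)" and A: "trim K A"
  shows "pseudo_indecomposable W A"
  unfolding pseudo_indecomposable_def
proof (intro conjI ballI impI)
  show ACo: "A \<in> Co W" using A by (simp add: trim_def)
  fix B assume B: "B \<in> Co W" "B \<subseteq> A"
  show "principal_ideal W B \<simeq> principal_ideal W A \<or> principal_ideal W (A - B) \<simeq> principal_ideal W A"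
  proof (cases "B \<inter> core K = {}")
    case False
    then show ?thesis using trim_iso[OF cnt trim_subset[OF A B False] A] by simp
  next
    case True
    then have "(A - B) \<inter> core K \<noteq> {}" using A by (auto simp: trim_def)
    from trim_iso[OF cnt trim_subset[OF A Co_Diff[OF ACo B(1)] Diff_subset this] A]
    show ?thesis by simp
  qed
qed

lemma basis_imp_primitive:
  assumes "countable (Co W)"
  shows "primitive_space W"
  unfolding primitive_space_def
proof
  fix A assume "A \<in> Co W"
  then obtain F where F: "finite F" "disjoint F" "\<forall>X\<in>F. \<exists>L. trim L X" "\<Union>F = A"
    using Co_trim_sum unfolding trim_sum_def by metis
  then have "\<forall>X\<in>F. pseudo_indecomposable W X" using trim_PI[OF assms] by blast
  then show "\<exists>F. finite F \<and> disjoint F \<and> (\<forall>B\<in>F. pseudo_indecomposable W B) \<and> \<Union>F = A"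
    using F by (intro exI[of _ F]) simp
qed

end

section \<open>Primitive spaces and join irreducible elements\<close>

theorem theorem5p3:
  fixes W :: "'a topology" and V :: "'a set set"
  assumes "omega_stone_space W"
    and "complete_heyting_star_subalgebra W V"
    and "V \<subseteq> Inv W"
  shows "primitive_space W \<longleftrightarrow> basis_for (cji V) V"
proof
  have st: "stone W" and cnt: "countable (Co W)"
    using assms(1) by (simp_all add: omega_stone_space_def stone_def)
  show "basis_for (cji V) V" if "primitive_space W"
    using stone.primitive_imp_basis[OF st that assms(2,3)] .
  show "primitive_space W" if "basis_for (cji V) V"
  proof -
    have "cji_basis W V"
      using st assms(2) that by (simp add: cji_basis_def cji_basis_axioms_def)
    then show ?thesis
      using cnt by (rule cji_basis.basis_imp_primitive)
  qed
qed

end
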